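(* Let $(M_t)_{t\ge 0}$ be a nonnegative discrete-time supermartingale with $M_0=1$, and let $S_t=\max_{s\le t}M_s$. Fix a probability distribution $\mu$ on $\mathbb{R}$, let $g^\mu(x)=\bar\mu^{-1}(1/x)$ for $x\ge1$, and let $Y$ be the process $$Y_t=\left(1-\frac{M_t}{S_t}\right)g^\mu(S_t)+M_t\int_{S_t}^\infty\frac{g^\mu(x)}{x^2}\,dx .$$ Define $\tau^\mu:=\min\{t: g^\mu(S_t)\ge Y_t\}$. Then $\max_{s\le\tau^\mu}Y_s\preceq\mu^{\mathrm{HL}}$, and $Y_{\tau^\mu}\preceq\mu$.
   Context: For a distribution $\mu$ on $\mathbb{R}$: the complementary CDF is $\bar\mu(x)=\Pr_{X\sim\mu}(X\ge x)$; the tail quantile function is $\bar\mu^{-1}(\xi)=\inf\{x:\bar\mu(x)<\xi\}$ for $\xi\in(0,1]$; the superquantile function is $\mathrm{SQ}^\mu(\xi)=\frac1\xi\int_0^\xi\bar\mu^{-1}(\lambda)\,d\lambda$; and the Hardy–Littlewood transform $\mu^{\mathrm{HL}}$ is the distribution of $\mathrm{SQ}^\mu(\mathcal{U})$ with $\mathcal{U}$ uniform on $[0,1]$. Standing assumption: $g^\mu(x)/x^2$ has a finite integral on any closed interval away from zero; since $g^\mu$ is defined on $[1,\infty)$, this means that it is integrable on $[1,\infty)$. For a random variable $X$ and a distribution $\nu$, $X\preceq\nu$ means $\Pr(X\ge c)\le\bar\nu(c)$ for all $c\in\mathbb{R}$. If $g^\mu(1)=-\infty$, a product $0\cdot(-\infty)$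 in the formula for $Y_t$ is read as $0$. *)

theory Defs
  imports "HOL-Probability.Probability"
begin

text \<open>
  Non-strict complementary CDF: the mass of \<open>{x..}\<close>, atom at \<open>x\<close> included.
\<close>

definition ccdf :: "real measure \<Rightarrow> real \<Rightarrow> real" where
  "ccdf \<mu> x = measure \<mu> {x..}"

text \<open>
  The infimum is taken in the extended reals. For a probability distribution it is a real number
  for \<open>0 < \<xi> < 1\<close>; at \<open>\<xi> = 1\<close> it is \<open>-\<infinity>\<close> when the support is unbounded below.
\<close>

definition tail_quantile :: "real measure \<Rightarrow> real \<Rightarrow> ereal" where
  "tail_quantile \<mu> \<xi> = Inf (ereal ` {x. ccdf \<mu> x < \<xi>})"

text \<open>
  In the integrals below \<open>real_of_ereal\<close> only affects the integrand at the single point where the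
  tail quantile (at \<open>1\<close>) may be \<open>-\<infinity>\<close>, a null set.
\<close>

definition superquantile :: "real measure \<Rightarrow> real \<Rightarrow> real" where
  "superquantile \<mu> \<xi> =
     1 / \<xi> * (LINT l:{0<..\<xi>}|lborel. real_of_ereal (tail_quantile \<mu> l))"

definition HL_transform :: "real measure \<Rightarrow> real measure" where
  "HL_transform \<mu> = distr (uniform_measure lborel {0..1}) borel (superquantile \<mu>)"

definition g_fun :: "real measure \<Rightarrow> real \<Rightarrow> ereal" where
  "g_fun \<mu> x = tail_quantile \<mu> (1 / x)"

definition g_integrable :: "real measure \<Rightarrow> bool" where
  "g_integrable \<mu> \<longleftrightarrow> set_integrable lborel {1..} (\<lambda>x. real_of_ereal (g_fun \<mu> x) / x\<^sup>2)"

text \<open>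
  The random variable may take infinite values; measurability is part of being a random
  variable, and ensures that the events compared are measurable.
\<close>

definition tail_dominated :: "'a measure \<Rightarrow> ('a \<Rightarrow> ereal) \<Rightarrow> real measure \<Rightarrow> bool" where
  "tail_dominated P X \<nu> \<longleftrightarrow>
     X \<in> borel_measurable P \<and>
     (\<forall>c::real. measure P {\<omega> \<in> space P. X \<omega> \<ge> ereal c} \<le> ccdf \<nu> c)"

locale discrete_supermartingale =
  prob_space P + filtration "space P" F
  for P :: "'a measure" and F :: "nat \<Rightarrow> 'a measure" and M :: "nat \<Rightarrow> 'a \<Rightarrow> real" +
  assumes subalg: "\<And>t. subalgebra P (F t)"
    and adapted: "\<And>t. M t \<in> borel_measurable (F t)"
    and integrable: "\<And>t. integrable P (M t)"
    and cond_exp_le: "\<And>s t. s \<le> t \<Longrightarrow> AE \<omega> in P. real_cond_exp P (F s) (M t) \<omega> \<le> M s \<omega>"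

definition running_max :: "(nat \<Rightarrow> 'a \<Rightarrow> real) \<Rightarrow> nat \<Rightarrow> 'a \<Rightarrow> real" where
  "running_max M t \<omega> = Max ((\<lambda>s. M s \<omega>) ` {..t})"

text \<open>
  Multiplication on \<^typ>\<open>ereal\<close> satisfies \<open>0 * (-\<infinity>) = 0\<close>, as required for the
  first summand when \<open>M t \<omega> = running_max M t \<omega> = 1\<close> and \<open>g_fun \<mu> 1 = -\<infinity>\<close>.
\<close>

definition Y_process :: "real measure \<Rightarrow> (nat \<Rightarrow> 'a \<Rightarrow> real) \<Rightarrow> nat \<Rightarrow> 'a \<Rightarrow> ereal" where
  "Y_process \<mu> M t \<omega> =
     ereal (1 - M t \<omega> / running_max M t \<omega>) * g_fun \<mu> (running_max M t \<omega>) +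
     ereal (M t \<omega> *
       (LINT x:{running_max M t \<omega>..}|lborel. real_of_ereal (g_fun \<mu> x) / x\<^sup>2))"

text \<open>The minimum of the empty set is \<open>\<infinity>\<close>: the time may be infinite.\<close>

definition tau :: "real measure \<Rightarrow> (nat \<Rightarrow> 'a \<Rightarrow> real) \<Rightarrow> 'a \<Rightarrow> enat" where
  "tau \<mu> M \<omega> = Inf (enat ` {t. g_fun \<mu> (running_max M t \<omega>) \<ge> Y_process \<mu> M t \<omega>})"

text \<open>
  The maximum over \<open>s \<le> T\<close>; where \<open>T\<close> is infinite, the supremum over all times.
\<close>

definition max_upto :: "(nat \<Rightarrow> 'a \<Rightarrow> ereal) \<Rightarrow> ('a \<Rightarrow> enat) \<Rightarrow> 'a \<Rightarrow> ereal" where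
  "max_upto Y T \<omega> = (SUP s\<in>{s. enat s \<le> T \<omega>}. Y s \<omega>)"

text \<open>
  \<open>Y\<^sub>T\<close> is defined only where \<open>T\<close> is finite. The value \<open>-\<infinity>\<close> elsewhere makes
  \<open>{Y\<^sub>T \<ge> c}\<close> the event \<open>{T < \<infinity> and Y\<^sub>T \<ge> c}\<close> for every real \<open>c\<close>. No
  limiting value is used: for \<open>M \<equiv> 1\<close> and nondegenerate \<open>\<mu>\<close> the time \<open>tau \<mu> M\<close> is infinite
  and \<open>Y_process \<mu> M\<close> is constantly the mean of \<open>\<mu>\<close>, which is not dominated by \<open>\<mu>\<close>.
\<close>

definition stopped_at :: "(nat \<Rightarrow> 'a \<Rightarrow> ereal) \<Rightarrow> ('a \<Rightarrow> enat) \<Rightarrow> 'a \<Rightarrow> ereal" where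
  "stopped_at Y T \<omega> = (case T \<omega> of enat t \<Rightarrow> Y t \<omega> | \<infinity> \<Rightarrow> -\<infinity>)"

end

(* Substituting x = 1/l turns the integral in Y_t into an integral of the tail quantile q, so with
   w = M_t / S_t in [0,1] the process is the convex combination
     Y_t = (1 - w) q(1/S_t) + w SQ(1/S_t).
   Since q <= SQ and SQ is nonincreasing, Y_t >= c forces 1/S_t to be at most xi for every
   xi with SQ(xi) < c. Doob's maximal inequality bounds the probability of that by xi, and the
   infimum of these xi in (0,1] (or 1, if there is none) is the tail of the Hardy-Littlewood
   transform at c. The stopping time plays no role here. It enters in the second bound only through
   Y_tau <= q(1/S_tau), and q(xi) >= c is equivalent to xi <= ccdf c. *)
theory Submission
  imports Defs
begin

section \<open>The tail quantile as generalized inverse of the complementary CDF\<close>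

text \<open>Left continuity of the non-strict complementary CDF: the rays starting at x - 1/(n+1)
  decrease to the closed ray at x, so their masses converge to \<open>ccdf \<mu> x\<close>.\<close>

lemma ccdf_less_imp_less_left:
  assumes "real_distribution \<mu>" "ccdf \<mu> x < \<xi>"
  shows "\<exists>y<x. ccdf \<mu> y < \<xi>"
proof -
  interpret real_distribution \<mu> by fact
  have "(\<lambda>n. measure \<mu> {x - 1 / real (Suc n)..}) \<longlonglongrightarrow> measure \<mu> (\<Inter>n. {x - 1 / real (Suc n)..})"
    by (intro finite_Lim_measure_decseq)
       (auto simp: decseq_def field_simps intro!: order_trans[OF diff_left_mono])
  also have "(\<Inter>n. {x - 1 / real (Suc n)..}) = {x..}"
  proof (intro equalityI subsetI)
    fix y assume y: "y \<in> (\<Inter>n. {x - 1 / real (Suc n)..})"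
    have "x \<le> y"
    proof (rule LIMSEQ_le_const2)
      show "(\<lambda>n. x - 1 / real (Suc n)) \<longlonglongrightarrow> x"
        using tendsto_diff[OF tendsto_const LIMSEQ_inverse_real_of_nat, of x] by (simp add: divide_inverse)
    qed (use y in auto)
    then show "y \<in> {x..}" by simp
  next
    fix y assume "y \<in> {x..}"
    then show "y \<in> (\<Inter>n. {x - 1 / real (Suc n)..})" by (auto intro: order_trans[rotated])
  qed
  finally have "eventually (\<lambda>n. measure \<mu> {x - 1 / real (Suc n)..} < \<xi>) sequentially"
    using assms(2) by (auto simp: ccdf_def intro: order_tendstoD(2))
  then obtain n where "measure \<mu> {x - 1 / real (Suc n)..} < \<xi>"
    by (auto simp: eventually_sequentially)
  then show ?thesis by (intro exI[of _ "x - 1 / real (Suc n)"]) (auto simp: ccdf_def)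
qed

lemma ccdf_antimono:
  assumes "real_distribution \<mu>" "x \<le> y"
  shows "ccdf \<mu> y \<le> ccdf \<mu> x"
proof -
  interpret real_distribution \<mu> by fact
  show ?thesis unfolding ccdf_def by (rule finite_measure_mono) (use assms in auto)
qed

text \<open>A Galois connection. If \<open>ccdf \<mu> c\<close> is below \<xi>, left continuity puts
  some y < c into the set whose infimum is the quantile, so the quantile drops strictly below c.
  Conversely, monotonicity forces every point of that set above c.\<close>

lemma le_tail_quantile_iff:
  assumes "real_distribution \<mu>"
  shows "ereal c \<le> tail_quantile \<mu> \<xi> \<longleftrightarrow> \<xi> \<le> ccdf \<mu> c"
proof
  assume *: "ereal c \<le> tail_quantile \<mu> \<xi>"
  show "\<xi> \<le> ccdf \<mu> c"
  proof (rule ccontr)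
    assume "\<not> \<xi> \<le> ccdf \<mu> c"
    then obtain y where "y < c" "ccdf \<mu> y < \<xi>" using ccdf_less_imp_less_left[OF assms] by force
    then have "tail_quantile \<mu> \<xi> \<le> ereal y" unfolding tail_quantile_def by (intro Inf_lower) auto
    with * \<open>y < c\<close> show False by (metis ereal_less_eq(3) order_trans not_le)
  qed
next
  assume "\<xi> \<le> ccdf \<mu> c"
  then show "ereal c \<le> tail_quantile \<mu> \<xi>"
    unfolding tail_quantile_def
  proof (intro Inf_greatest, clarify)
    fix x assume "ccdf \<mu> x < \<xi>"
    with \<open>\<xi> \<le> ccdf \<mu> c\<close> have "\<not> x \<le> c" using ccdf_antimono[OF assms, of x c] by linarith
    then show "ereal c \<le> ereal x" by simp
  qed
qed

lemma tail_quantile_antimono: "\<xi> \<le> \<eta> \<Longrightarrow> tail_quantile \<mu> \<eta> \<le> tail_quantile \<mu> \<xi>"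
  unfolding tail_quantile_def by (intro Inf_superset_mono image_mono) auto

text \<open>The limits of the CDF at both ends of the line supply a and b with a \<le> quantile < b
  + 1. Both endpoints are excluded: at 1 the quantile may be -\<infinity>, and at 0 it is
  \<infinity>.\<close>

lemma tail_quantile_finite:
  assumes "real_distribution \<mu>" "0 < \<xi>" "\<xi> < 1"
  shows "\<bar>tail_quantile \<mu> \<xi>\<bar> \<noteq> \<infinity>"
proof -
  interpret real_distribution \<mu> by fact
  have eq: "ccdf \<mu> x = 1 - measure \<mu> {..<x}" for x
    using prob_compl[of "{..<x}"] by (auto simp: ccdf_def Compl_eq_Diff_UNIV[symmetric])
  have "eventually (\<lambda>x. measure \<mu> {..x} < 1 - \<xi>) at_bot"
    using cdf_lim_at_bot assms by (auto simp: cdf_def intro!: order_tendstoD(2))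
  then obtain a where "measure \<mu> {..a} < 1 - \<xi>" by (auto simp: eventually_at_bot_linorder)
  moreover have "measure \<mu> {..<a} \<le> measure \<mu> {..a}" by (rule finite_measure_mono) auto
  ultimately have "ereal a \<le> tail_quantile \<mu> \<xi>" by (simp add: le_tail_quantile_iff assms eq)
  moreover
  have "eventually (\<lambda>x. 1 - \<xi> < measure \<mu> {..x}) at_top"
    using cdf_lim_at_top_prob assms by (auto simp: cdf_def intro!: order_tendstoD(1))
  then obtain b where "1 - \<xi> < measure \<mu> {..b}" by (auto simp: eventually_at_top_linorder)
  \<comment> \<open>The CDF measures closed rays, whereas the complement of \<open>{x..}\<close> is
    open; the shift to b + 1 bridges the two.\<close>
  moreover have "measure \<mu> {..b} \<le> measure \<mu> {..<b+1}" by (rule finite_measure_mono) auto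
  ultimately have "\<not> ereal (b+1) \<le> tail_quantile \<mu> \<xi>" by (simp add: le_tail_quantile_iff assms eq)
  with \<open>ereal a \<le> _\<close> show ?thesis by (cases "tail_quantile \<mu> \<xi>") auto
qed

text \<open>By the Galois connection the preimage of a closed upper ray with real endpoint is the
  half-line up to the \<open>ccdf\<close> of that endpoint; the endpoint \<infinity> is reached by a
  countable intersection.\<close>

lemma tail_quantile_measurable [measurable]:
  assumes "real_distribution \<mu>"
  shows "tail_quantile \<mu> \<in> borel_measurable borel"
  unfolding borel_measurable_iff_Ici_ereal
proof
  fix a :: ereal
  show "tail_quantile \<mu> -` {a..} \<inter> space borel \<in> sets borel"
  proof (cases a)
    case (real r)
    then have "tail_quantile \<mu> -` {a..} = {..ccdf \<mu> r}" by (auto simp: le_tail_quantile_iff assms)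
    then show ?thesis by simp
  next
    case PInf
    have "x = \<infinity> \<longleftrightarrow> (\<forall>n::nat. ereal (real n) \<le> x)" for x :: ereal
      by (cases x) (auto simp: not_le reals_Archimedean2)
    then have "tail_quantile \<mu> -` {a..} = (\<Inter>n::nat. {..ccdf \<mu> (real n)})"
      unfolding PInf le_tail_quantile_iff[OF assms, symmetric] set_eq_iff
      by (simp add: le_tail_quantile_iff[OF assms])
    then show ?thesis by simp
  next
    case MInf
    then have "tail_quantile \<mu> -` {a..} = UNIV" by auto
    then show ?thesis by simp
  qed
qed

section \<open>The substitution x = 1/l\<close>

lemma inverse_image_atLeast: "0 < s \<Longrightarrow> (\<lambda>x. 1 / x) ` {s..} = {0<..1 / (s::real)}"
proof (intro equalityI subsetI)
  fix y assume "0 < s" "y \<in> {0<..1 / s}"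
  then show "y \<in> (\<lambda>x. 1 / x) ` {s..}"
    by (intro image_eqI[of _ _ "1 / y"]) (auto simp: field_simps)
qed (auto simp: field_simps)

text \<open>The weight 1/x^2 is the absolute derivative of 1/x, so the weighted integral of g over a
  ray becomes a plain integral of the quantile near 0.\<close>

lemma change_of_variables_inverse:
  fixes f :: "real \<Rightarrow> real"
  assumes [measurable]: "f \<in> borel_measurable borel" and s: "0 < s"
    and int: "set_integrable lborel {s..} (\<lambda>x. f (1 / x) / x\<^sup>2)"
  shows "set_integrable lborel {0<..1 / s} f"
    and "(LINT l:{0<..1 / s}|lborel. f l) = (LINT x:{s..}|lborel. f (1 / x) / x\<^sup>2)"
proof -
  \<comment> \<open>The change of variables theorem speaks of \<open>lebesgue\<close>. For Borel
    integrands the completion of \<open>lborel\<close> alters neither integrability nor the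
    value.\<close>
  have leb: "set_integrable lebesgue A h = set_integrable lborel A h"
            "set_lebesgue_integral lebesgue A h = set_lebesgue_integral lborel A h"
    if "A \<in> sets borel" "h \<in> borel_measurable borel" for A and h :: "real \<Rightarrow> real"
    using that unfolding set_integrable_def set_lebesgue_integral_def
    by (auto intro!: integrable_completion integral_completion)
  let ?h = "\<lambda>x. \<bar>- 1 / x\<^sup>2\<bar> * f (1 / x)"
  have h: "?h = (\<lambda>x. f (1 / x) / x\<^sup>2)" by auto
  have int': "?h absolutely_integrable_on {s..}"
    unfolding h using int by (subst leb) auto
  have "f absolutely_integrable_on (\<lambda>x. 1 / x) ` {s..} \<and>
      integral ((\<lambda>x. 1 / x) ` {s..}) f = integral {s..} ?h"
  proof (rule has_absolute_integral_change_of_variables_1'[THEN iffD1])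
    show "((\<lambda>x. 1 / x) has_real_derivative - 1 / x\<^sup>2) (at x within {s..})" if "x \<in> {s..}" for x
      using that s by (auto intro!: derivative_eq_intros simp: power2_eq_square)
    show "inj_on (\<lambda>x. 1 / x) {s..}" by (auto simp: inj_on_def)
  qed (use int' in auto)
  then have *: "f absolutely_integrable_on {0<..1 / s}" "integral {0<..1 / s} f = integral {s..} ?h"
    by (simp_all add: inverse_image_atLeast s)
  show "set_integrable lborel {0<..1 / s} f"
    using *(1) by (subst (asm) leb) auto
  show "(LINT l:{0<..1 / s}|lborel. f l) = (LINT x:{s..}|lborel. f (1 / x) / x\<^sup>2)"
    using *(2) set_lebesgue_integral_eq_integral(2)[OF *(1)] set_lebesgue_integral_eq_integral(2)[OF int']
    unfolding h by (simp add: leb)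
qed

section \<open>The superquantile and its relation to Y\<close>

locale integrable_tail_distribution =
  fixes \<mu> :: "real measure"
  assumes distribution: "real_distribution \<mu>" and g_integrable: "g_integrable \<mu>"
begin

abbreviation tq :: "real \<Rightarrow> real" where
  "tq \<xi> \<equiv> real_of_ereal (tail_quantile \<mu> \<xi>)"

lemma tq_measurable [measurable]: "tq \<in> borel_measurable borel"
  using tail_quantile_measurable[OF distribution] by measurable

lemma tq_integrable: "set_integrable lborel {0<..1} tq"
  using change_of_variables_inverse(1)[of tq 1] g_integrable by (simp add: g_integrable_def g_fun_def)

lemma tq_integrable_subset: "0 \<le> \<xi> \<Longrightarrow> \<eta> \<le> 1 \<Longrightarrow> set_integrable lborel {\<xi><..\<eta>} tq"
  by (rule set_integrable_subset[OF tq_integrable]) auto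

text \<open>This identifies the integral in Y: at s = S_t the second summand is M_t/S_t times the
  superquantile at 1/S_t.\<close>

lemma superquantile_eq:
  assumes "1 \<le> s"
  shows "superquantile \<mu> (1 / s) = s * (LINT x:{s..}|lborel. real_of_ereal (g_fun \<mu> x) / x\<^sup>2)"
proof -
  have "set_integrable lborel {s..} (\<lambda>x. tq (1 / x) / x\<^sup>2)"
    using g_integrable assms unfolding g_integrable_def g_fun_def
    by (rule_tac set_integrable_subset) auto
  from change_of_variables_inverse(2)[OF _ _ this] assms
  show ?thesis by (simp add: superquantile_def g_fun_def)
qed

text \<open>The superquantile averages the quantile over (0,\<xi>], and a nonincreasing function is
  smallest at the right end.\<close>

lemma tail_quantile_le_superquantile:
  assumes "0 < \<xi>" "\<xi> \<le> 1"
  shows "tail_quantile \<mu> \<xi> \<le> ereal (superquantile \<mu> \<xi>)"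
proof (rule ccontr)
  assume "\<not> ?thesis"
  \<comment> \<open>A real c strictly in between allows for a quantile that may be infinite at \<xi>
    = 1.\<close>
  then obtain c where c: "ereal c \<le> tail_quantile \<mu> \<xi>" "superquantile \<mu> \<xi> < c"
    by (metis ereal_dense2 less_ereal.simps(1) less_imp_le not_le)
  have "c * \<xi> = (LINT l:{0<..\<xi>}|lborel. c)"
    using assms by (simp add: set_integral_const)
  also have "\<dots> \<le> (LINT l:{0<..\<xi>}|lborel. tq l)"
  proof (rule set_integral_mono)
    fix l assume l: "l \<in> {0<..\<xi>}"
    then have "ereal c \<le> tail_quantile \<mu> l"
      using c tail_quantile_antimono[of l \<xi> \<mu>] by (auto intro: order_trans)
    \<comment> \<open>Finiteness is known only below 1; since l = 1 can occur, l is compared with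
      \<open>min l (1/2)\<close>, where the quantile is at least as large.\<close>
    moreover have "tail_quantile \<mu> l \<noteq> \<infinity>"
      using l tail_quantile_antimono[of "min l (1/2)" l \<mu>]
        tail_quantile_finite[OF distribution, of "min l (1/2)"] by (auto simp: min_less_iff_disj)
    ultimately show "c \<le> tq l" by (cases "tail_quantile \<mu> l") auto
  qed (use assms tq_integrable_subset[of 0 \<xi>] in \<open>auto simp: set_integrable_def\<close>)
  finally have "c \<le> superquantile \<mu> \<xi>"
    using assms by (simp add: superquantile_def field_simps)
  with c show False by simp
qed

text \<open>The superquantile at \<eta> is a weighted mean of the one at \<xi> and the average of
  the quantile over (\<xi>,\<eta>]. That average is at most the quantile at \<xi>, hence at most the
  superquantile at \<xi>.\<close>

lemma superquantile_antimono:
  assumes "0 < \<xi>" "\<xi> \<le> \<eta>" "\<eta> \<le> 1"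
  shows "superquantile \<mu> \<eta> \<le> superquantile \<mu> \<xi>"
proof (cases "\<xi> = \<eta>")
  case False
  with assms have "\<xi> < \<eta>" "\<xi> < 1" by auto
  define c where "c = tq \<xi>"
  have c: "tail_quantile \<mu> \<xi> = ereal c"
    using tail_quantile_finite[OF distribution, of \<xi>] assms \<open>\<xi> < 1\<close> by (simp add: c_def ereal_real')
  have "(LINT l:{\<xi><..\<eta>}|lborel. tq l) \<le> (LINT l:{\<xi><..\<eta>}|lborel. c)"
  proof (rule set_integral_mono_AE)
    (* At l = 1 the tail quantile may be -\<infinity>, where real_of_ereal gives 0. *)
    have "AE l in lborel. l \<noteq> (1 :: real)" by (rule AE_lborel_singleton)
    then show "AE l\<in>{\<xi><..\<eta>} in lborel. tq l \<le> c"
    proof eventually_elim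
      case (elim l)
      show ?case
      proof
        assume l: "l \<in> {\<xi><..\<eta>}"
        then have "\<bar>tail_quantile \<mu> l\<bar> \<noteq> \<infinity>"
          using elim assms by (intro tail_quantile_finite distribution) auto
        moreover have "tail_quantile \<mu> l \<le> ereal c"
          using l tail_quantile_antimono[of \<xi> l \<mu>] c by simp
        ultimately show "tq l \<le> c" by (cases "tail_quantile \<mu> l") auto
      qed
    qed
  qed (use assms tq_integrable_subset[of \<xi> \<eta>] in \<open>auto simp: set_integrable_def\<close>)
  also have "\<dots> = (\<eta> - \<xi>) * c" using assms by (simp add: set_integral_const)
  also have "\<dots> \<le> (\<eta> - \<xi>) * superquantile \<mu> \<xi>"
    using tail_quantile_le_superquantile[of \<xi>] assms c by (intro mult_left_mono) auto
  finally have "(LINT l:{\<xi><..\<eta>}|lborel. tq l) \<le> (\<eta> - \<xi>) * superquantile \<mu> \<xi>" .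
  moreover have "(LINT l:{0<..\<eta>}|lborel. tq l) =
      (LINT l:{0<..\<xi>}|lborel. tq l) + (LINT l:{\<xi><..\<eta>}|lborel. tq l)"
  proof -
    have "{0<..\<eta>} = {0<..\<xi>} \<union> {\<xi><..\<eta>}" using assms by auto
    then show ?thesis
      using assms by (simp only:) (rule set_integral_Un, auto intro!: tq_integrable_subset)
  qed
  moreover have "(LINT l:{0<..\<xi>}|lborel. tq l) = \<xi> * superquantile \<mu> \<xi>"
    using assms by (simp add: superquantile_def)
  ultimately have "(LINT l:{0<..\<eta>}|lborel. tq l) \<le> \<eta> * superquantile \<mu> \<xi>"
    by (simp add: algebra_simps)
  then show ?thesis
    using assms by (simp add: superquantile_def[of _ \<eta>] field_simps)
qed simp

text \<open>With the moving domain written as a condition in the integrand, the integrand is jointly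
  measurable in l and \<xi>, so the parameter integral is measurable.\<close>

lemma superquantile_measurable [measurable]: "superquantile \<mu> \<in> borel_measurable borel"
proof -
  have "superquantile \<mu> \<xi> = 1 / \<xi> * (LINT l|lborel. (if 0 < l \<and> l \<le> \<xi> then tq l else 0))" for \<xi>
    unfolding superquantile_def set_lebesgue_integral_def
    by (intro arg_cong2[where f="(*)"] refl Bochner_Integration.integral_cong) auto
  then have "superquantile \<mu> =
      (\<lambda>\<xi>. 1 / \<xi> * (LINT l|lborel. (if 0 < l \<and> l \<le> \<xi> then tq l else 0)))" by (rule ext)
  then show ?thesis by simp
qed

text \<open>If the superquantile at \<xi> were at least c, monotonicity would give the same on all
  of (0,\<xi>], a set of uniform mass \<xi>, and the transform would have tail at least \<xi> at
  c.\<close>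

lemma superquantile_less:
  assumes \<xi>: "ccdf (HL_transform \<mu>) c < \<xi>" "\<xi> \<le> 1"
  shows "superquantile \<mu> \<xi> < c"
proof (rule ccontr)
  assume "\<not> superquantile \<mu> \<xi> < c"
  let ?U = "uniform_measure lborel {0..1::real}"
  interpret U: prob_space ?U by (rule prob_space_uniform_measure) auto
  have "0 < \<xi>" using \<xi> by (auto simp: ccdf_def intro: order.strict_trans1[rotated])
  \<comment> \<open>The point 0 is left out because the superquantile has only the default value 0
    there.\<close>
  have "\<xi> = measure ?U {0<..\<xi>}"
  proof -
    have "{0..1} \<inter> {0<..\<xi>} = {0<..\<xi>}" using \<xi> \<open>0 < \<xi>\<close> by auto
    then show ?thesis using \<open>0 < \<xi>\<close> by (simp add: measure_uniform_measure)
  qed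
  also have "\<dots> \<le> measure ?U (superquantile \<mu> -` {c..} \<inter> space ?U)"
  proof (rule U.finite_measure_mono)
    show "superquantile \<mu> -` {c..} \<inter> space ?U \<in> sets ?U"
      by (rule measurable_sets[of _ _ borel]) auto
    show "{0<..\<xi>} \<subseteq> superquantile \<mu> -` {c..} \<inter> space ?U"
      using order_trans[OF _ superquantile_antimono[of _ \<xi>], of c] \<xi> \<open>\<not> superquantile \<mu> \<xi> < c\<close>
      by (fastforce simp: not_less)
  qed
  also have "\<dots> = ccdf (HL_transform \<mu>) c"
    by (simp add: ccdf_def HL_transform_def measure_distr)
  finally show False using \<xi> by simp
qed

lemma Y_process_le_superquantile:
  assumes "0 \<le> M t \<omega>" "1 \<le> M 0 \<omega>"
  shows "Y_process \<mu> M t \<omega> \<le> ereal (superquantile \<mu> (1 / running_max M t \<omega>))"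
proof -
  let ?m = "M t \<omega>" and ?s = "running_max M t \<omega>"
  have "?m \<le> ?s" "M 0 \<omega> \<le> ?s" by (auto simp: running_max_def)
  with assms have "1 \<le> ?s" by simp
  define q where "q = superquantile \<mu> (1 / ?s)"
  define w where "w = ?m / ?s"
  have w: "0 \<le> w" "w \<le> 1" using \<open>1 \<le> ?s\<close> \<open>?m \<le> ?s\<close> assms by (auto simp: w_def)
  have "?m * (LINT x:{?s..}|lborel. real_of_ereal (g_fun \<mu> x) / x\<^sup>2) = w * q"
    using superquantile_eq[OF \<open>1 \<le> ?s\<close>] \<open>1 \<le> ?s\<close> by (simp add: q_def w_def)
  then have Y: "Y_process \<mu> M t \<omega> = ereal (1 - w) * g_fun \<mu> ?s + ereal (w * q)"
    by (simp add: Y_process_def w_def)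
  have "g_fun \<mu> ?s \<le> ereal q"
    using \<open>1 \<le> ?s\<close> unfolding g_fun_def q_def by (intro tail_quantile_le_superquantile) auto
  \<comment> \<open>The comparison stays in the extended reals: at S = 1 the quantile may be
    -\<infinity>, and for w = 1 the product 0 * (-\<infinity>) is 0.\<close>
  then have "ereal (1 - w) * g_fun \<mu> ?s \<le> ereal (1 - w) * ereal q"
    using w by (intro ereal_mult_left_mono) auto
  then have "Y_process \<mu> M t \<omega> \<le> ereal (1 - w) * ereal q + ereal (w * q)"
    unfolding Y by (rule add_right_mono)
  then show ?thesis by (simp add: q_def algebra_simps)
qed

end

section \<open>Doob's maximal inequality for supermartingales\<close>

lemma (in discrete_supermartingale) set_integral_M_Suc_le:
  assumes "A \<in> sets (F t)"
  shows "(LINT \<omega>:A|P. M (Suc t) \<omega>) \<le> (LINT \<omega>:A|P. M t \<omega>)"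
proof -
  interpret S: finite_measure_subalgebra P "F t" by unfold_locales (rule subalg)
  have A: "A \<in> sets P" using assms subalg[of t] by (auto simp: subalgebra_def)
  have "(LINT \<omega>:A|P. M (Suc t) \<omega>) = (LINT \<omega>:A|P. real_cond_exp P (F t) (M (Suc t)) \<omega>)"
    by (rule S.real_cond_exp_intA) (use integrable assms in auto)
  also have "\<dots> \<le> (LINT \<omega>:A|P. M t \<omega>)"
    unfolding set_lebesgue_integral_def
  proof (rule integral_mono_AE)
    show "integrable P (\<lambda>x. indicat_real A x *\<^sub>R real_cond_exp P (F t) (M (Suc t)) x)"
      using S.real_cond_exp_int(1)[OF integrable] A integrable_mult_indicator by blast
    show "integrable P (\<lambda>x. indicat_real A x *\<^sub>R M t x)"
      using integrable A integrable_mult_indicator by blast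
    show "AE x in P. indicat_real A x *\<^sub>R real_cond_exp P (F t) (M (Suc t)) x \<le> indicat_real A x *\<^sub>R M t x"
      using cond_exp_le[of t "Suc t", simplified] by eventually_elim (auto split: split_indicator)
  qed
  finally show ?thesis .
qed

lemma (in discrete_supermartingale) M_measurable [measurable]: "M t \<in> borel_measurable P"
  using measurable_from_subalg[OF subalg adapted] .

text \<open>Induction along the process stopped on first reaching x. Keeping the integral over the
  paths still below x closes the induction: paths that reach x at time n move to the first term,
  having contributed at least x times their probability, and on the others the supermartingale
  property applies.\<close>

lemma (in discrete_supermartingale) maximal_inequality_finite:
  assumes "0 \<le> x"
  shows "x * prob {\<omega>\<in>space P. \<exists>s<n. x \<le> M s \<omega>}
    + (LINT \<omega>:{\<omega>\<in>space P. \<forall>s<n. M s \<omega> < x}|P. M n \<omega>) \<le> (LINT \<omega>|P. M 0 \<omega>)"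
proof (induction n)
  case 0
  show ?case by (simp add: set_integral_space integrable)
next
  case (Suc n)
  let ?B = "\<lambda>n. {\<omega>\<in>space P. \<forall>s<n. M s \<omega> < x}"
  let ?E = "\<lambda>n. {\<omega>\<in>space P. \<exists>s<n. x \<le> M s \<omega>}"
  let ?A = "{\<omega>\<in>space P. (\<forall>s<n. M s \<omega> < x) \<and> x \<le> M n \<omega>}"
  have int: "set_integrable P B (M t)" if "B \<in> sets P" for B t
    unfolding set_integrable_def using integrable that integrable_mult_indicator by blast
  \<comment> \<open>Staying below x up to and including time n is decided by \<open>M 0\<close>,
    ..., \<open>M n\<close>, as the one-step inequality requires.\<close>
  have BF: "?B (Suc n) \<in> sets (F n)"
  proof -
    have "{\<omega>\<in>space (F n). M s \<omega> < x} \<in> sets (F n)" if "s < Suc n" for s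
    proof -
      have "{\<omega>\<in>space (F s). M s \<omega> < x} \<in> sets (F s)"
        by (rule borel_measurable_less[OF adapted borel_measurable_const])
      then show ?thesis using sets_F_mono[of s n] that by (auto simp: space_F)
    qed
    then have "{\<omega>\<in>space (F n). \<forall>s\<in>{..<Suc n}. M s \<omega> < x} \<in> sets (F n)"
      by (intro sets.sets_Collect_finite_All) auto
    also have "{\<omega>\<in>space (F n). \<forall>s\<in>{..<Suc n}. M s \<omega> < x} = ?B (Suc n)" by (auto simp: space_F)
    finally show ?thesis .
  qed
  \<comment> \<open>\<open>?A\<close> is the event that level x is first reached at time n.\<close>
  have "prob (?E (Suc n)) = prob (?E n) + prob ?A"
  proof -
    have "(\<exists>s<Suc n. x \<le> M s \<omega>) \<longleftrightarrow> (\<exists>s<n. x \<le> M s \<omega>) \<or> (\<forall>s<n. M s \<omega> < x) \<and> x \<le> M n \<omega>" for \<omega>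
      by (cases "\<exists>s<n. x \<le> M s \<omega>") (auto simp: less_Suc_eq not_le)
    then have "?E (Suc n) = ?E n \<union> ?A" by blast
    moreover have "?E n \<inter> ?A = {}" by (blast dest: leD)
    moreover have "?E n \<in> sets P" "?A \<in> sets P" by measurable
    ultimately show ?thesis by (simp only: finite_measure_Union)
  qed
  moreover have "(LINT \<omega>:?B n|P. M n \<omega>) = (LINT \<omega>:?A|P. M n \<omega>) + (LINT \<omega>:?B (Suc n)|P. M n \<omega>)"
  proof -
    have "(\<forall>s<Suc n. M s \<omega> < x) \<longleftrightarrow> (\<forall>s<n. M s \<omega> < x) \<and> \<not> x \<le> M n \<omega>" for \<omega>
      by (auto simp: less_Suc_eq)
    then have "?B n = ?A \<union> ?B (Suc n)" "?A \<inter> ?B (Suc n) = {}" by blast+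
    moreover have "?A \<in> sets P" "?B (Suc n) \<in> sets P" by measurable
    ultimately show ?thesis by (simp only: set_integral_Un int)
  qed
  moreover have "x * prob ?A \<le> (LINT \<omega>:?A|P. M n \<omega>)"
  proof -
    have A: "?A \<in> sets P" by measurable
    then have "x * prob ?A = (LINT \<omega>:?A|P. x)" by (simp add: set_integral_const)
    also have "\<dots> \<le> (LINT \<omega>:?A|P. M n \<omega>)"
    proof (rule set_integral_mono)
      show "set_integrable P ?A (\<lambda>_. x)"
        unfolding set_integrable_def by (rule integrable_mult_indicator[OF A integrable_const])
    qed (use int[OF A] in auto)
    finally show ?thesis .
  qed
  moreover have "(LINT \<omega>:?B (Suc n)|P. M (Suc n) \<omega>) \<le> (LINT \<omega>:?B (Suc n)|P. M n \<omega>)"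
    by (rule set_integral_M_Suc_le[OF BF])
  ultimately show ?case using Suc by (simp add: algebra_simps)
qed

text \<open>Nonnegativity lets the integral over the surviving paths be dropped; continuity from
  below then removes the time horizon.\<close>

lemma (in discrete_supermartingale) maximal_inequality:
  assumes nonneg: "\<And>t. AE \<omega> in P. 0 \<le> M t \<omega>" and "0 < x"
  shows "x * prob {\<omega>\<in>space P. \<exists>t. x \<le> M t \<omega>} \<le> (LINT \<omega>|P. M 0 \<omega>)"
proof -
  have "(\<lambda>n. prob {\<omega>\<in>space P. \<exists>s<n. x \<le> M s \<omega>}) \<longlonglongrightarrow> prob (\<Union>n. {\<omega>\<in>space P. \<exists>s<n. x \<le> M s \<omega>})"
    by (rule finite_Lim_measure_incseq) (auto simp: incseq_def intro: order.strict_trans2)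
  also have "(\<Union>n. {\<omega>\<in>space P. \<exists>s<n. x \<le> M s \<omega>}) = {\<omega>\<in>space P. \<exists>t. x \<le> M t \<omega>}" by auto
  finally have "(\<lambda>n. x * prob {\<omega>\<in>space P. \<exists>s<n. x \<le> M s \<omega>}) \<longlonglongrightarrow> x * prob {\<omega>\<in>space P. \<exists>t. x \<le> M t \<omega>}"
    by (intro tendsto_mult) auto
  then show ?thesis
  proof (rule LIMSEQ_le_const2, intro exI allI impI)
    fix n
    have "0 \<le> (LINT \<omega>:{\<omega>\<in>space P. \<forall>s<n. M s \<omega> < x}|P. M n \<omega>)"
      unfolding set_lebesgue_integral_def
      by (rule integral_nonneg_AE) (use nonneg[of n] in eventually_elim, auto split: split_indicator)
    with maximal_inequality_finite[of x n] \<open>0 < x\<close>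
    show "x * prob {\<omega>\<in>space P. \<exists>s<n. x \<le> M s \<omega>} \<le> (LINT \<omega>|P. M 0 \<omega>)" by simp
  qed
qed

section \<open>Measurability and the behaviour of the stopping time\<close>

lemma borel_measurable_integral_atLeast [measurable]:
  fixes f :: "real \<Rightarrow> real"
  assumes [measurable]: "f \<in> borel_measurable borel"
  shows "(\<lambda>s. LINT x:{s..}|lborel. f x) \<in> borel_measurable borel"
proof -
  have "(LINT x:{s..}|lborel. f x) = (LINT x|lborel. (if s \<le> x then f x else 0))" for s
    unfolding set_lebesgue_integral_def by (rule Bochner_Integration.integral_cong) auto
  then show ?thesis by simp
qed

text \<open>The filler -\<infinity> is neutral for suprema, so the random index set can be replaced
  by all natural numbers.\<close>

lemma max_upto_measurable:
  assumes [measurable]: "\<And>s. Y s \<in> borel_measurable P" "\<And>s. Measurable.pred P (\<lambda>\<omega>. enat s \<le> T \<omega>)"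
  shows "max_upto Y T \<in> borel_measurable P"
proof -
  have "max_upto Y T \<omega> = (SUP s. if enat s \<le> T \<omega> then Y s \<omega> else -\<infinity>)" for \<omega>
    unfolding max_upto_def
  proof (intro antisym SUP_least)
    fix s assume "s \<in> {s. enat s \<le> T \<omega>}"
    then show "Y s \<omega> \<le> (SUP s. if enat s \<le> T \<omega> then Y s \<omega> else -\<infinity>)"
      by (intro SUP_upper2[of s]) auto
  qed (auto intro: SUP_upper2)
  then have "max_upto Y T = (\<lambda>\<omega>. SUP s. if enat s \<le> T \<omega> then Y s \<omega> else -\<infinity>)" by (rule ext)
  then show ?thesis by (simp only:) measurable
qed

text \<open>At most one index s satisfies s \<le> T but not s + 1 \<le> T, namely s = T. For
  infinite T only the filler remains, which agrees with the default.\<close>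

lemma stopped_at_measurable:
  assumes [measurable]: "\<And>s. Y s \<in> borel_measurable P" "\<And>s. Measurable.pred P (\<lambda>\<omega>. enat s \<le> T \<omega>)"
  shows "stopped_at Y T \<in> borel_measurable P"
proof -
  have "stopped_at Y T \<omega> =
      (SUP s. if enat s \<le> T \<omega> \<and> \<not> enat (Suc s) \<le> T \<omega> then Y s \<omega> else -\<infinity>)" for \<omega>
  proof (cases "T \<omega>")
    case (enat t)
    then have "(if enat s \<le> T \<omega> \<and> \<not> enat (Suc s) \<le> T \<omega> then Y s \<omega> else -\<infinity>) =
        (if s = t then Y t \<omega> else -\<infinity>)" for s
      by auto
    then show ?thesis
      using enat by (simp only: stopped_at_def) (auto intro!: antisym SUP_least SUP_upper2[of t])
  qed (simp add: stopped_at_def)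
  then have "stopped_at Y T =
      (\<lambda>\<omega>. SUP s. if enat s \<le> T \<omega> \<and> \<not> enat (Suc s) \<le> T \<omega> then Y s \<omega> else -\<infinity>)" by (rule ext)
  then show ?thesis by (simp only:) measurable
qed

lemma enat_le_tau_iff:
  "enat s \<le> tau \<mu> M \<omega> \<longleftrightarrow>
     (\<forall>t<s. \<not> Y_process \<mu> M t \<omega> \<le> g_fun \<mu> (running_max M t \<omega>))"
  unfolding tau_def le_Inf_iff by (auto simp: not_less)

text \<open>The infimum is attained: the condition fails at all times before t, but not at all times
  before t + 1.\<close>

lemma Y_process_le_at_tau:
  assumes "tau \<mu> M \<omega> = enat t"
  shows "Y_process \<mu> M t \<omega> \<le> g_fun \<mu> (running_max M t \<omega>)"
  using enat_le_tau_iff[of t \<mu> M \<omega>] enat_le_tau_iff[of "Suc t" \<mu> M \<omega>] assms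
  by (auto simp: less_Suc_eq)

lemma le_running_max_iff: "c \<le> running_max M t \<omega> \<longleftrightarrow> (\<exists>s\<le>t. c \<le> M s \<omega>)"
  by (auto simp: running_max_def Max_ge_iff)

section \<open>The two tail bounds from level crossings of M\<close>

theorem theorem9:
  fixes P :: "'a measure" and F :: "nat \<Rightarrow> 'a measure"
    and M :: "nat \<Rightarrow> 'a \<Rightarrow> real" and \<mu> :: "real measure"
  assumes "discrete_supermartingale P F M"
    and "\<And>t. AE \<omega> in P. 0 \<le> M t \<omega>"
    and "AE \<omega> in P. M 0 \<omega> = 1"
    and "real_distribution \<mu>"
    and "g_integrable \<mu>"
  shows "tail_dominated P (max_upto (Y_process \<mu> M) (tau \<mu> M)) (HL_transform \<mu>)
       \<and> tail_dominated P (stopped_at (Y_process \<mu> M) (tau \<mu> M)) \<mu>"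
proof -
  interpret discrete_supermartingale P F M by fact
  interpret integrable_tail_distribution \<mu> using assms(4,5) by (rule integrable_tail_distribution.intro)
  have [measurable]: "running_max M t \<in> borel_measurable P" for t
    unfolding running_max_def[abs_def] by (rule borel_measurable_Max) auto
  have [measurable]: "g_fun \<mu> \<in> borel_measurable borel"
    unfolding g_fun_def[abs_def] using tail_quantile_measurable[OF distribution] by measurable
  have Y[measurable]: "Y_process \<mu> M t \<in> borel_measurable P" for t
    unfolding Y_process_def[abs_def] by measurable
  have T: "Measurable.pred P (\<lambda>\<omega>. enat s \<le> tau \<mu> M \<omega>)" for s
    unfolding enat_le_tau_iff by measurable
  note max_measurable = max_upto_measurable[OF Y T] and stopped_measurable = stopped_at_measurable[OF Y T]
  note [measurable] = max_measurable stopped_measurable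
  have start: "AE \<omega> in P. M 0 \<omega> = 1 \<and> (\<forall>t. 0 \<le> M t \<omega>)"
    using assms(2,3) by (simp add: AE_all_countable)
  have "(LINT \<omega>|P. M 0 \<omega>) = (LINT \<omega>|P. 1)"
    by (rule integral_cong_AE) (use assms(3) in auto)
  then have "(LINT \<omega>|P. M 0 \<omega>) = 1" by (simp add: prob_space)
  \<comment> \<open>Doob's inequality at level 1/\<xi>, with initial mean 1.\<close>
  then have crossing: "prob {\<omega>\<in>space P. \<exists>t. 1 / \<xi> \<le> M t \<omega>} \<le> \<xi>" if "0 < \<xi>" for \<xi>
    using maximal_inequality[of "1 / \<xi>"] assms(2) that by (simp add: field_simps)
  have "prob {\<omega>\<in>space P. ereal c \<le> max_upto (Y_process \<mu> M) (tau \<mu> M) \<omega>} \<le> ccdf (HL_transform \<mu>) c"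
    (is "prob ?E \<le> ?K") for c
  proof (cases "?K < 1")
    case True
    show ?thesis
    \<comment> \<open>It suffices to bound the probability by every \<xi> strictly between
      \<open>?K\<close> and 1, because the superquantile is known to be below c only for \<xi>
      strictly above \<open>?K\<close>.\<close>
    proof (rule dense_ge_bounded[OF True])
      fix \<xi> assume \<xi>: "?K < \<xi>" "\<xi> < 1"
      then have "0 < \<xi>" by (auto simp: ccdf_def intro: order.strict_trans1[rotated])
      have "prob ?E \<le> prob {\<omega>\<in>space P. \<exists>t. 1 / \<xi> \<le> M t \<omega>}"
      proof (rule finite_measure_mono_AE)
        show "AE \<omega> in P. \<omega> \<in> ?E \<longrightarrow> \<omega> \<in> {\<omega>\<in>space P. \<exists>t. 1 / \<xi> \<le> M t \<omega>}"
          using start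
        proof eventually_elim
          case (elim \<omega>)
          \<comment> \<open>Without a crossing, \<xi> < 1/S_t at every time, so all Y_t share the
            bound given by the superquantile at \<xi>. Being uniform in t, it passes to the supremum
            and keeps it strictly below c even for infinite \<open>tau\<close>.\<close>
          have "max_upto (Y_process \<mu> M) (tau \<mu> M) \<omega> < ereal c" if no: "\<not> (\<exists>t. 1 / \<xi> \<le> M t \<omega>)"
          proof -
            have "Y_process \<mu> M t \<omega> \<le> ereal (superquantile \<mu> \<xi>)" for t
            proof -
              have "1 \<le> running_max M t \<omega>" "running_max M t \<omega> < 1 / \<xi>"
                using elim no le_running_max_iff[of 1 M t \<omega>] le_running_max_iff[of "1 / \<xi>" M t \<omega>] by auto
              then have "superquantile \<mu> (1 / running_max M t \<omega>) \<le> superquantile \<mu> \<xi>"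
                using \<open>0 < \<xi>\<close> by (intro superquantile_antimono) (auto simp: field_simps)
              moreover have "Y_process \<mu> M t \<omega> \<le> ereal (superquantile \<mu> (1 / running_max M t \<omega>))"
                using elim by (intro Y_process_le_superquantile) auto
              ultimately show ?thesis by (meson ereal_less_eq(3) order_trans)
            qed
            then have "max_upto (Y_process \<mu> M) (tau \<mu> M) \<omega> \<le> ereal (superquantile \<mu> \<xi>)"
              unfolding max_upto_def by (intro SUP_least)
            also have "\<dots> < ereal c" using superquantile_less[of c \<xi>] \<xi> by simp
            finally show ?thesis .
          qed
          then show ?case by (auto simp: not_le[symmetric])
        qed
      qed measurable
      also have "\<dots> \<le> \<xi>" by (rule crossing) fact
      finally show "prob ?E \<le> \<xi>" .
    qed
  qed (use prob_le_1 in \<open>auto simp: not_less intro: order_trans\<close>)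
  moreover
  have "prob {\<omega>\<in>space P. ereal c \<le> stopped_at (Y_process \<mu> M) (tau \<mu> M) \<omega>} \<le> ccdf \<mu> c"
    (is "prob ?E \<le> ?K") for c
  proof -
    \<comment> \<open>The positivity of \<open>?K\<close> is part of the claim so that the event is
      seen to be null when \<open>?K\<close> is 0, where 1 / \<open>?K\<close> is no meaningful
      level.\<close>
    have *: "AE \<omega> in P. \<omega> \<in> ?E \<longrightarrow> 0 < ?K \<and> (\<exists>t. 1 / ?K \<le> M t \<omega>)"
      using start
    proof eventually_elim
      case (elim \<omega>)
      show ?case
      proof
        assume "\<omega> \<in> ?E"
        \<comment> \<open>A real c lies above the default -\<infinity>, so \<open>tau\<close> is
          finite on this event.\<close>
        then obtain t where t: "tau \<mu> M \<omega> = enat t" "ereal c \<le> Y_process \<mu> M t \<omega>"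
          by (auto simp: stopped_at_def split: enat.splits)
        \<comment> \<open>At \<open>tau\<close> the quantile at 1/S dominates Y, hence c; the Galois
          connection turns this into a bound on 1/S.\<close>
        then have "1 / running_max M t \<omega> \<le> ?K"
          using Y_process_le_at_tau[OF t(1)] le_tail_quantile_iff[OF distribution]
          by (auto simp: g_fun_def intro: order_trans)
        moreover have "1 \<le> running_max M t \<omega>" using elim by (auto simp: le_running_max_iff)
        moreover from calculation have "0 < ?K"
          by (smt (verit) divide_pos_pos)
        ultimately have "0 < ?K" "1 / ?K \<le> running_max M t \<omega>"
          by (auto simp: field_simps)
        then show "0 < ?K \<and> (\<exists>t. 1 / ?K \<le> M t \<omega>)" by (auto simp: le_running_max_iff)
      qed
    qed
    show ?thesis
    proof (cases "0 < ?K")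
      case True
      have "prob ?E \<le> prob {\<omega>\<in>space P. \<exists>t. 1 / ?K \<le> M t \<omega>}"
        by (rule finite_measure_mono_AE) (use * in auto)
      then show ?thesis using crossing[OF True] by simp
    next
      case False
      have "prob ?E \<le> prob {}"
        by (rule finite_measure_mono_AE) (use * False in auto)
      also have "\<dots> \<le> ?K" by (simp add: ccdf_def)
      finally show ?thesis .
    qed
  qed
  ultimately show ?thesis
    unfolding tail_dominated_def using max_measurable stopped_measurable by auto
qed

end
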